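(* For all integers $m\ge 1$, $k\ge 1$, $n\ge 1$, let $r_R(m,k,n)$ be the largest real number $r$ such that for every multicake $C$ with $m$ islands and every $n$ value-measures $V_1,\dots,V_n$ on $C$ there exists a $k$-feasible allocation $(Z_1,\dots,Z_n)$ of $C$ with $V_i(Z_i)\ge r\cdot V_i(\mathrm{Best}^k_i(C))$ for all $i\in\{1,\dots,n\}$, where $\mathrm{Best}^k_i(C)$ is the union of the $k$ islands of $C$ most valuable to agent $i$. Then $$r_R(m,k,n)=\frac1n .$$
   Context: A multicake $C$ with $m$ islands is the union of $m$ pairwise-disjoint intervals of unit length on the real line; these $m$ intervals are the islands. A value-measure on $C$ is a function of the form $V(Z)=\int_{Z} v(x)\,dx$ for (measurable) $Z\subseteq C$, where $v:C\to\mathbb{R}_{\ge 0}$ is integrable. An allocation is a vector $(Z_1,\dots,Z_n)$ of pairwise-disjoint subsets of $C$; their union need not be all of $C$ (free disposal). An allocation is $k$-feasible if each $Z_i$ is the union of at most $k$ intervals, each contained in a single island. $\mathrm{Best}^k_i(C)$ denotes the union of $k$ islands of $C$ having the largest values under $V_i$ (ties broken arbitrarily; all of $C$ if $m\le k$). *)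

theory Defs
  imports "HOL-Analysis.Analysis"
begin

text \<open>A multicake is represented by its set of islands; the cake itself is the union of this set.
  The islands may be open, closed or half-open. The set of islands is kept, because it cannot be
  recovered from the union when two islands are adjacent.\<close>

definition multicake :: "nat \<Rightarrow> real set set \<Rightarrow> bool" where
  "multicake m Is \<longleftrightarrow> finite Is \<and> card Is = m \<and> disjoint Is \<and>
     (\<forall>I\<in>Is. is_interval I \<and> emeasure lebesgue I = 1)"

definition value_measure :: "real set \<Rightarrow> (real set \<Rightarrow> real) \<Rightarrow> bool" where
  "value_measure C V \<longleftrightarrow>
     (\<exists>v. (\<forall>x\<in>C. 0 \<le> v x) \<and> set_integrable lebesgue C v \<and>
          (\<forall>Z\<in>sets lebesgue. Z \<subseteq> C \<longrightarrow> V Z = (LINT x:Z|lebesgue. v x)))"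

definition allocation :: "real set \<Rightarrow> nat \<Rightarrow> (nat \<Rightarrow> real set) \<Rightarrow> bool" where
  "allocation C n Z \<longleftrightarrow> (\<forall>i\<in>{1..n}. Z i \<subseteq> C) \<and> disjoint_family_on Z {1..n}"

definition k_feasible :: "real set set \<Rightarrow> nat \<Rightarrow> nat \<Rightarrow> (nat \<Rightarrow> real set) \<Rightarrow> bool" where
  "k_feasible Is k n Z \<longleftrightarrow>
     (\<forall>i\<in>{1..n}. \<exists>P. finite P \<and> card P \<le> k \<and> Z i = \<Union>P \<and>
        (\<forall>J\<in>P. is_interval J \<and> (\<exists>I\<in>Is. J \<subseteq> I)))"

text \<open>\<open>is_Best Is k V B\<close>: the set \<open>B\<close> is a possible value of \<open>Best\<^sup>k\<close>, for some way of breaking ties.\<close>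

definition is_Best :: "real set set \<Rightarrow> nat \<Rightarrow> (real set \<Rightarrow> real) \<Rightarrow> real set \<Rightarrow> bool" where
  "is_Best Is k V B \<longleftrightarrow>
     (\<exists>Js\<subseteq>Is. card Js = min k (card Is) \<and> B = \<Union>Js \<and> (\<forall>J\<in>Js. \<forall>I\<in>Is - Js. V I \<le> V J))"

definition guarantees :: "nat \<Rightarrow> nat \<Rightarrow> nat \<Rightarrow> real \<Rightarrow> bool" where
  "guarantees m k n r \<longleftrightarrow>
     (\<forall>Is V B. multicake m Is \<longrightarrow>
        (\<forall>i\<in>{1..n}. value_measure (\<Union>Is) (V i)) \<longrightarrow>
        (\<forall>i\<in>{1..n}. is_Best Is k (V i) (B i)) \<longrightarrow>
        (\<exists>Z. allocation (\<Union>Is) n Z \<and> k_feasible Is k n Z \<and>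
             (\<forall>i\<in>{1..n}. V i (Z i) \<ge> r * V i (B i))))"

definition r_R :: "nat \<Rightarrow> nat \<Rightarrow> nat \<Rightarrow> real" where
  "r_R m k n = (GREATEST r. guarantees m k n r)"

end

theory Submission
  imports Defs
begin

text \<open>The ratio \<open>1 / n\<close> is attained by treating the islands independently. On one island the
  last-diminisher procedure gives each of the \<open>n\<close> agents an interval worth at least \<open>1 / n\<close> of that
  island to him (\<open>last_diminisher\<close>). Each agent then keeps only his pieces on the (at most \<open>k\<close>) islands of
  his own \<open>Best\<^sup>k\<close> and throws the others away. The kept pieces number at most \<open>k\<close>, and summing
  over the islands of \<open>Best\<^sup>k\<close> gives \<open>1 / n\<close> of its total value (\<open>guarantees_inverse\<close>).

  No larger ratio is possible: if all agents value the length of one and the same island and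
  nothing else, then \<open>Best\<^sup>k\<close> is worth \<open>1\<close> to everybody while disjoint pieces are worth at most
  \<open>1\<close> together, so some agent gets at most \<open>1 / n\<close> (\<open>guarantees_le_inverse\<close>).\<close>

section \<open>Value measures\<close>

lemma lebesgue_interval: "is_interval (I::real set) \<Longrightarrow> I \<in> sets lebesgue"
  using real_interval_borel_measurable by (simp add: sets_completionI_sets)

lemma value_measure_nonneg:
  assumes "value_measure C V" "Z \<in> sets lebesgue" "Z \<subseteq> C"
  shows "0 \<le> V Z"
proof -
  obtain v where v: "\<forall>x\<in>C. 0 \<le> v x" "V Z = (LINT x:Z|lebesgue. v x)"
    using assms unfolding value_measure_def by blast
  then show ?thesis
    unfolding set_lebesgue_integral_def v(2) using assms(3)
    by (intro Bochner_Integration.integral_nonneg) (auto simp: indicator_def)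
qed

lemma value_measure_finite_Union:
  assumes "value_measure C V" "finite T" "disjoint_family_on A T"
    and "\<And>i. i \<in> T \<Longrightarrow> A i \<in> sets lebesgue" "\<And>i. i \<in> T \<Longrightarrow> A i \<subseteq> C"
  shows "V (\<Union>i\<in>T. A i) = (\<Sum>i\<in>T. V (A i))"
proof -
  obtain v where v: "set_integrable lebesgue C v"
      "\<And>Z. Z \<in> sets lebesgue \<Longrightarrow> Z \<subseteq> C \<Longrightarrow> V Z = (LINT x:Z|lebesgue. v x)"
    using assms(1) unfolding value_measure_def by blast
  have "V (\<Union>i\<in>T. A i) = (LINT x:(\<Union>i\<in>T. A i)|lebesgue. v x)"
    using assms by (intro v(2)) auto
  also have "\<dots> = (\<Sum>i\<in>T. LINT x:A i|lebesgue. v x)"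
    using assms set_integrable_subset[OF v(1)] by (intro set_integral_finite_Union) auto
  also have "\<dots> = (\<Sum>i\<in>T. V (A i))"
    using assms v(2) by (intro sum.cong) auto
  finally show ?thesis .
qed

lemma value_measure_Un:
  assumes "value_measure C V" "A \<in> sets lebesgue" "B \<in> sets lebesgue" "A \<subseteq> C" "B \<subseteq> C"
    and "A \<inter> B = {}"
  shows "V (A \<union> B) = V A + V B"
proof -
  let ?A = "\<lambda>b. if b then A else B"
  have "disjoint_family_on ?A UNIV"
    using assms(6) by (auto simp: disjoint_family_on_def)
  then have "V (\<Union>b\<in>UNIV. ?A b) = (\<Sum>b\<in>UNIV. V (?A b))"
    using assms by (intro value_measure_finite_Union) auto
  then show ?thesis
    by (simp add: UNIV_bool Un_commute)
qed

lemma value_measure_mono: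
  assumes "value_measure C V" "A \<in> sets lebesgue" "B \<in> sets lebesgue" "A \<subseteq> B" "B \<subseteq> C"
  shows "V A \<le> V B"
proof -
  have "V (A \<union> (B - A)) = V A + V (B - A)"
    using assms by (intro value_measure_Un[OF assms(1)]) auto
  moreover have "0 \<le> V (B - A)"
    using assms by (intro value_measure_nonneg[OF assms(1)]) auto
  moreover have "A \<union> (B - A) = B"
    using assms(4) by blast
  ultimately show ?thesis by simp
qed

text \<open>A value measure has a density, so the value to the left of a cut depends continuously on the
  cut and takes all intermediate values.\<close>

lemma value_measure_cut:
  assumes V: "value_measure C V" and I: "is_interval I" "bounded I" "I \<subseteq> C"
    and c: "0 \<le> c" "c \<le> V I"
  shows "\<exists>t. V (I \<inter> {..t}) = c"
proof -
  obtain v where v: "set_integrable lebesgue C v"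
      "\<And>Z. Z \<in> sets lebesgue \<Longrightarrow> Z \<subseteq> C \<Longrightarrow> V Z = (LINT x:Z|lebesgue. v x)"
    using V unfolding value_measure_def by blast
  obtain B where B: "\<And>x. x \<in> I \<Longrightarrow> \<bar>x\<bar> \<le> B" "0 < B"
    using I(2) unfolding bounded_pos by auto
  define g where "g x = indicator I x * v x" for x
  have I_sets: "I \<in> sets lebesgue"
    using I(1) by (rule lebesgue_interval)
  have "set_integrable lebesgue I v"
    using set_integrable_subset[OF v(1)] I I_sets by blast
  then have g_UNIV: "set_integrable lebesgue UNIV g"
    by (simp add: set_integrable_def g_def)
  have g: "set_integrable lebesgue {-B..t} g" for t
    by (rule set_integrable_subset[OF g_UNIV]) auto
  have V_eq: "V (I \<inter> {..t}) = integral {-B..t} g" for t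
  proof -
    have "V (I \<inter> {..t}) = (LINT x:I \<inter> {..t}|lebesgue. v x)"
      using I I_sets by (intro v(2)) auto
    also have "\<dots> = (LINT x:{-B..t}|lebesgue. g x)"
      unfolding set_lebesgue_integral_def g_def using B(1)
      by (intro Bochner_Integration.integral_cong) (force simp: indicator_def abs_le_iff)+
    also have "\<dots> = integral {-B..t} g"
      by (rule set_lebesgue_integral_eq_integral(2)[OF g])
    finally show ?thesis .
  qed
  have "continuous_on {-B..B} (\<lambda>t. V (I \<inter> {..t}))"
    unfolding V_eq
    by (rule indefinite_integral_continuous_1[OF set_lebesgue_integral_eq_integral(1)[OF g]])
  moreover have "V (I \<inter> {..-B}) \<le> c"
    unfolding V_eq using c(1) by simp
  moreover have "I \<inter> {..B} = I"
    using B(1) by (force simp: abs_le_iff)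
  ultimately show ?thesis
    using IVT'[of "\<lambda>t. V (I \<inter> {..t})" "-B" c B] B(2) c(2) by auto
qed

section \<open>Proportional division of one interval\<close>

text \<open>Each agent marks where, counted from the left, exactly his due \<open>c i\<close> is reached. The agent
  with the leftmost mark receives everything up to it; this part is worth at most their due to the others, so that the remainder
  still suffices for them. Stating the dues as fixed numbers instead of fractions of \<open>I\<close> is what
  makes the induction go through.\<close>

lemma last_diminisher:
  assumes "finite A" "is_interval I" "bounded I" "I \<subseteq> C"
    and "\<And>i. i \<in> A \<Longrightarrow> value_measure C (V i)"
    and "\<And>i. i \<in> A \<Longrightarrow> 0 \<le> c i"
    and "\<And>i. i \<in> A \<Longrightarrow> real (card A) * c i \<le> V i I"
  shows "\<exists>Z. disjoint_family_on Z A \<and>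
           (\<forall>i\<in>A. is_interval (Z i) \<and> Z i \<subseteq> I \<and> c i \<le> V i (Z i))"
  using assms
proof (induction "card A" arbitrary: A I)
  case 0
  then show ?case by (auto simp: disjoint_family_on_def)
next
  case (Suc s)
  have V: "value_measure C (V i)" and c: "0 \<le> c i" if "i \<in> A" for i
    using Suc.prems that by auto
  have due: "c i + real s * c i \<le> V i I" if "i \<in> A" for i
    using Suc.prems(7)[OF that] by (simp add: Suc.hyps(2)[symmetric] algebra_simps)
  have ne: "A \<noteq> {}" using Suc.hyps(2) by auto
  have "\<exists>t. V i (I \<inter> {..t}) = c i" if "i \<in> A" for i
  proof (rule value_measure_cut[OF V[OF that] Suc.prems(2-4) c[OF that]])
    have "0 \<le> real s * c i" using c[OF that] by simp
    then show "c i \<le> V i I" using due[OF that] by linarith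
  qed
  then obtain t where t: "\<And>i. i \<in> A \<Longrightarrow> V i (I \<inter> {..t i}) = c i"
    by metis
  have "Min (t ` A) \<in> t ` A"
    using ne Suc.prems(1) by (intro Min_in) auto
  then obtain a where a: "a \<in> A" "t a = Min (t ` A)"
    by (metis imageE)
  then have a_min: "t a \<le> t i" if "i \<in> A" for i
    using that Suc.prems(1) by simp
  let ?L = "I \<inter> {..t a}" and ?R = "I \<inter> {t a<..}"
  have ints: "is_interval ?L" "is_interval ?R"
    using Suc.prems(2) by (auto simp: is_interval_1)
  have I_Un: "?L \<union> ?R = I" by auto
  have card: "card (A - {a}) = s"
    using a(1) Suc.hyps(2) Suc.prems(1) by simp
  have rest: "real s * c i \<le> V i ?R" if "i \<in> A" for i
  proof -
    have "V i (?L \<union> ?R) = V i ?L + V i ?R"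
      using Suc.prems(4) ints lebesgue_interval
      by (intro value_measure_Un[OF V[OF that]]) auto
    moreover have "V i ?L \<le> V i (I \<inter> {..t i})"
      using a_min[OF that] Suc.prems ints(1)
      by (intro value_measure_mono[OF V[OF that]])
         (auto intro!: lebesgue_interval is_interval_Int is_interval_ic)
    ultimately show ?thesis
      using t[OF that] due[OF that] I_Un by simp
  qed
  have "\<exists>Z. disjoint_family_on Z (A - {a}) \<and>
          (\<forall>i\<in>A - {a}. is_interval (Z i) \<and> Z i \<subseteq> ?R \<and> c i \<le> V i (Z i))"
    using Suc.prems ints card rest
    by (intro Suc.hyps(1)) (auto intro: bounded_subset)
  then obtain Z where Z: "disjoint_family_on Z (A - {a})"
      "\<And>i. i \<in> A - {a} \<Longrightarrow> is_interval (Z i) \<and> Z i \<subseteq> ?R \<and> c i \<le> V i (Z i)"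
    by blast
  have "?L \<inter> Z i = {}" if "i \<in> A - {a}" for i
    using Z(2)[OF that] by force
  then have "disjoint_family_on (Z(a := ?L)) A"
    using Z(1) unfolding disjoint_family_on_def by (auto simp: Int_commute)
  moreover have "\<forall>i\<in>A. is_interval ((Z(a := ?L)) i) \<and> (Z(a := ?L)) i \<subseteq> I \<and>
      c i \<le> V i ((Z(a := ?L)) i)"
    using Z(2) ints(1) t[OF a(1)] by force
  ultimately show ?case by blast
qed

section \<open>Every agent can receive the fraction \<open>1 / n\<close>\<close>

text \<open>Two points of an interval enclose a segment, so points far apart would force a large
  measure. Boundedness is what lets a cut be placed to the right of the whole island.\<close>

lemma bounded_island:
  assumes "is_interval (I::real set)" "emeasure lebesgue I = 1"
  shows "bounded I"
proof -
  have short: "y - x \<le> 1" if "x \<in> I" "y \<in> I" for x y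
  proof (cases "x \<le> y")
    case True
    have "{x..y} \<subseteq> I"
      using mem_is_interval_1_I[OF assms(1) that] by auto
    then have "emeasure lebesgue {x..y} \<le> 1"
      using emeasure_mono[OF _ lebesgue_interval[OF assms(1)]] assms(2) by metis
    moreover have "emeasure lebesgue {x..y} = ennreal (y - x)"
      using True by simp
    ultimately show ?thesis by simp
  qed simp
  show ?thesis
  proof (cases "I = {}")
    case False
    then obtain z where "z \<in> I" by blast
    then have "I \<subseteq> {z - 1..z + 1}" using short[of z] short[of _ z] by fastforce
    then show ?thesis using bounded_closed_interval bounded_subset by blast
  qed simp
qed

text \<open>Every island is divided among all \<open>n\<close> agents, also those who discard their piece of it.
  Sharing with them costs the others nothing that matters, since the fraction \<open>1 / n\<close> of each
  island of \<open>Best\<^sup>k\<close> is all that an agent is owed.\<close>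

lemma guarantees_inverse:
  assumes n: "n \<ge> 1"
  shows "guarantees m k n (1 / real n)"
  unfolding guarantees_def
proof (intro allI impI)
  fix Is V B
  assume M: "multicake m Is"
    and V: "\<forall>i\<in>{1..n}. value_measure (\<Union>Is) (V i)"
    and B: "\<forall>i\<in>{1..n}. is_Best Is k (V i) (B i)"
  have fin: "finite Is" and disj: "disjoint Is"
    and ints: "\<And>I. I \<in> Is \<Longrightarrow> is_interval I \<and> emeasure lebesgue I = 1"
    using M unfolding multicake_def by auto
  have I_sets: "I \<in> sets lebesgue" if "I \<in> Is" for I
    using ints[OF that] lebesgue_interval by blast
  have "\<exists>Z. disjoint_family_on Z {1..n} \<and>
          (\<forall>i\<in>{1..n}. is_interval (Z i) \<and> Z i \<subseteq> I \<and> V i I / real n \<le> V i (Z i))"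
    if "I \<in> Is" for I
  proof (rule last_diminisher)
    show "is_interval I" "bounded I" "I \<subseteq> \<Union>Is"
      using that ints[OF that] bounded_island by auto
    show "0 \<le> V i I / real n" if "i \<in> {1..n}" for i
      using value_measure_nonneg[OF V[rule_format, OF that] I_sets Union_upper] \<open>I \<in> Is\<close>
      by simp
  qed (use V n in auto)
  then obtain Z where Z: "\<And>I. I \<in> Is \<Longrightarrow> disjoint_family_on (Z I) {1..n}"
      "\<And>I i. I \<in> Is \<Longrightarrow> i \<in> {1..n} \<Longrightarrow>
         is_interval (Z I i) \<and> Z I i \<subseteq> I \<and> V i I / real n \<le> V i (Z I i)"
    by metis
  obtain Js where Js: "\<And>i. i \<in> {1..n} \<Longrightarrow>
      Js i \<subseteq> Is \<and> card (Js i) = min k (card Is) \<and> B i = \<Union>(Js i)"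
    using B unfolding is_Best_def by metis
  define W where "W i = (\<Union>I\<in>Js i. Z I i)" for i
  have disjD: "I = I'" if "I \<in> Is" "I' \<in> Is" "x \<in> I" "x \<in> I'" for I I' x
    using disj that by (auto simp: disjoint_def)
  have Js_disj: "disjoint_family_on (\<lambda>I. I) (Js i)"
    and Z_disj: "disjoint_family_on (\<lambda>I. Z I i) (Js i)" if i: "i \<in> {1..n}" for i
  proof -
    show "disjoint_family_on (\<lambda>I. I) (Js i)"
      using Js[OF i] disj by (auto simp: disjoint_family_on_def disjoint_def)
    then show "disjoint_family_on (\<lambda>I. Z I i) (Js i)"
      by (rule disjoint_family_on_bisimulation) (use Js[OF i] Z(2)[OF _ i] in blast)
  qed
  have Js_fin: "finite (Js i)" if "i \<in> {1..n}" for i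
    using Js[OF that] fin finite_subset by blast
  have "W i \<inter> W j = {}" if "i \<in> {1..n}" "j \<in> {1..n}" "i \<noteq> j" for i j
  proof -
    have "x \<notin> Z I i \<inter> Z I' j" if "I \<in> Js i" "I' \<in> Js j" for x I I'
    proof
      assume x: "x \<in> Z I i \<inter> Z I' j"
      have "I \<in> Is" "I' \<in> Is"
        using Js that \<open>i \<in> {1..n}\<close> \<open>j \<in> {1..n}\<close> by auto
      moreover from this have "x \<in> I" "x \<in> I'"
        using x Z(2) \<open>i \<in> {1..n}\<close> \<open>j \<in> {1..n}\<close> by blast+
      ultimately have "I = I'" by (rule disjD)
      then show False
        using x Z(1)[OF \<open>I \<in> Is\<close>] \<open>i \<in> {1..n}\<close> \<open>j \<in> {1..n}\<close> \<open>i \<noteq> j\<close>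
        unfolding disjoint_family_on_def by blast
    qed
    then show ?thesis unfolding W_def by blast
  qed
  moreover have "W i \<subseteq> \<Union>Is" if "i \<in> {1..n}" for i
    unfolding W_def
  proof (rule UN_least)
    fix I assume "I \<in> Js i"
    then have "I \<in> Is" using Js[OF that] by blast
    then show "Z I i \<subseteq> \<Union>Is" using Z(2)[OF _ that] by blast
  qed
  ultimately have "allocation (\<Union>Is) n W"
    by (auto simp: allocation_def disjoint_family_on_def)
  moreover have "k_feasible Is k n W"
    unfolding k_feasible_def
  proof
    fix i assume i: "i \<in> {1..n}"
    have "card ((\<lambda>I. Z I i) ` Js i) \<le> k"
      using card_image_le[OF Js_fin[OF i], of "\<lambda>I. Z I i"] Js[OF i] by linarith
    moreover have "\<forall>J\<in>(\<lambda>I. Z I i) ` Js i. is_interval J \<and> (\<exists>I\<in>Is. J \<subseteq> I)"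
    proof
      fix J assume "J \<in> (\<lambda>I. Z I i) ` Js i"
      then obtain I where "I \<in> Is" "J = Z I i" using Js[OF i] by blast
      then show "is_interval J \<and> (\<exists>I\<in>Is. J \<subseteq> I)" using Z(2)[OF _ i] by blast
    qed
    ultimately show "\<exists>P. finite P \<and> card P \<le> k \<and> W i = \<Union>P \<and>
        (\<forall>J\<in>P. is_interval J \<and> (\<exists>I\<in>Is. J \<subseteq> I))"
      using Js_fin[OF i] unfolding W_def by (intro exI[of _ "(\<lambda>I. Z I i) ` Js i"]) simp
  qed
  moreover have "1 / real n * V i (B i) \<le> V i (W i)" if i: "i \<in> {1..n}" for i
  proof -
    have Vi: "value_measure (\<Union>Is) (V i)" using V i by blast
    have "V i (\<Union>I\<in>Js i. I) = (\<Sum>I\<in>Js i. V i I)"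
      using Js[OF i] I_sets
      by (intro value_measure_finite_Union[OF Vi Js_fin[OF i] Js_disj[OF i]]) auto
    then have "1 / real n * V i (B i) = (\<Sum>I\<in>Js i. V i I / real n)"
      using Js[OF i] by (simp add: sum_divide_distrib)
    also have "\<dots> \<le> (\<Sum>I\<in>Js i. V i (Z I i))"
      using Js[OF i] Z(2)[OF _ i] by (intro sum_mono) blast
    also have "\<dots> = V i (W i)"
      unfolding W_def using Js[OF i] Z(2)[OF _ i]
      by (intro value_measure_finite_Union[OF Vi Js_fin[OF i] Z_disj[OF i], symmetric])
         (blast intro: lebesgue_interval)+
    finally show ?thesis .
  qed
  ultimately show "\<exists>Z. allocation (\<Union>Is) n Z \<and> k_feasible Is k n Z \<and>
      (\<forall>i\<in>{1..n}. V i (Z i) \<ge> 1 / real n * V i (B i))"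
    by (intro exI[of _ W] conjI ballI) simp_all
qed

section \<open>No larger fraction is possible\<close>

lemma value_measure_length:
  assumes "C \<in> sets lebesgue" "J \<in> lmeasurable"
  shows "value_measure C (\<lambda>Z. measure lebesgue (Z \<inter> J))"
  unfolding value_measure_def
proof (intro exI[of _ "indicator J"] conjI ballI impI)
  have ind: "indicator Z x *\<^sub>R indicator J x = (indicator (Z \<inter> J) x :: real)" for Z and x :: real
    by (simp add: indicator_inter_arith)
  show "set_integrable lebesgue C (indicator J :: real \<Rightarrow> real)"
    unfolding set_integrable_def ind
    using fmeasurable_Int_fmeasurable[OF assms(2,1)]
    by (intro integrable_real_indicator) (auto simp: fmeasurable_def Int_commute)
  show "measure lebesgue (Z \<inter> J) = (LINT x:Z|lebesgue. indicator J x)"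
    if "Z \<in> sets lebesgue" for Z
    unfolding set_lebesgue_integral_def ind by simp
qed simp

text \<open>The common value measure of the agents is the length within the island \<open>isl 0\<close>. The other
  islands are worthless, so any \<open>k\<close> islands including this one form \<open>Best\<^sup>k\<close>.\<close>

lemma guarantees_le_inverse:
  assumes m: "m \<ge> 1" and k: "k \<ge> 1" and n: "n \<ge> 1" and r: "guarantees m k n r"
  shows "r \<le> 1 / real n"
proof -
  \<comment> \<open>The gaps between these islands keep the closed intervals disjoint.\<close>
  define isl where "isl j = {2 * real j..2 * real j + 1}" for j :: nat
  define Is where "Is = isl ` {..<m}"
  define Js where "Js = isl ` {..<min k m}"
  define V where "V Z = measure lebesgue (Z \<inter> isl 0)" for Z
  have isl_disj: "isl i \<inter> isl j = {}" if "i \<noteq> j" for i j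
  proof -
    have "real i + 1 \<le> real j \<or> real j + 1 \<le> real i"
      using that by linarith
    then show ?thesis by (auto simp: isl_def)
  qed
  moreover have isl_ne: "isl i \<noteq> {}" for i
    by (simp add: isl_def)
  ultimately have inj: "inj_on isl S" for S
    by (metis inf.idem inj_onI)
  have "card Is = m"
    by (simp add: Is_def card_image[OF inj])
  moreover have "disjoint Is"
    unfolding Is_def disjoint_def using isl_disj by (metis imageE)
  ultimately have cake: "multicake m Is"
    by (auto simp: multicake_def Is_def isl_def)
  have VM: "value_measure (\<Union>Is) V"
    unfolding V_def isl_def Is_def by (intro value_measure_length) auto
  have V0: "V (isl j) = 0" if "j \<noteq> 0" for j
    using isl_disj[OF that] by (simp add: V_def)
  have V_nonneg: "0 \<le> V Z" for Z
    by (simp add: V_def)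
  have isl0: "isl 0 \<in> Js"
    using m k by (auto simp: Js_def)
  have best: "is_Best Is k V (\<Union>Js)"
    unfolding is_Best_def
  proof (intro exI[of _ Js] conjI ballI)
    show "Js \<subseteq> Is" "card Js = min k (card Is)"
      by (auto simp: Js_def Is_def card_image[OF inj])
    fix J I assume "I \<in> Is - Js"
    then obtain j where "I = isl j" "j \<noteq> 0"
      using isl0 by (auto simp: Is_def)
    then have "V I = 0" using V0 by simp
    then show "V I \<le> V J" using V_nonneg by simp
  qed simp
  have "\<Union>Js \<inter> isl 0 = isl 0"
    using isl0 by blast
  then have V_best: "V (\<Union>Js) = 1"
    by (simp add: V_def isl_def)
  obtain Z where Z: "allocation (\<Union>Is) n Z" "k_feasible Is k n Z"
      "\<forall>i\<in>{1..n}. V (Z i) \<ge> r * V (\<Union>Js)"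
    using r[unfolded guarantees_def, rule_format, of Is "\<lambda>_. V" "\<lambda>_. \<Union>Js"] cake VM best by blast
  have Z_sets: "Z i \<in> sets lebesgue" if i: "i \<in> {1..n}" for i
  proof -
    obtain P where P: "finite P" "Z i = \<Union>P" "\<forall>J\<in>P. is_interval J"
      using Z(2)[unfolded k_feasible_def, rule_format, OF i] by metis
    have "P \<subseteq> sets lebesgue"
      using P(3) lebesgue_interval by (intro subsetI) simp
    then show ?thesis
      unfolding P(2) by (rule sets.finite_Union[OF P(1)])
  qed
  have "real n * r = (\<Sum>i\<in>{1..n}. r)" by simp
  also have "\<dots> \<le> (\<Sum>i\<in>{1..n}. V (Z i))"
    using Z(3) V_best by (intro sum_mono) auto
  also have "\<dots> = V (\<Union>i\<in>{1..n}. Z i)"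
    using Z(1) Z_sets unfolding allocation_def
    by (intro value_measure_finite_Union[OF VM, symmetric]) auto
  also have "\<dots> \<le> measure lebesgue (isl 0)"
    unfolding V_def using Z_sets by (intro measure_mono_fmeasurable) (auto simp: isl_def)
  also have "\<dots> = 1" by (simp add: isl_def)
  finally show ?thesis
    using n by (simp add: field_simps)
qed

theorem theorem2:
  fixes m k n :: nat
  assumes "m \<ge> 1" and "k \<ge> 1" and "n \<ge> 1"
  shows "guarantees m k n (r_R m k n) \<and>
         (\<forall>r. guarantees m k n r \<longrightarrow> r \<le> r_R m k n) \<and>
         r_R m k n = 1 / real n"
proof -
  have "r_R m k n = 1 / real n"
    unfolding r_R_def
    using guarantees_inverse guarantees_le_inverse assms by (intro Greatest_equality)
  then show ?thesis
    using guarantees_inverse guarantees_le_inverse assms by metis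
qed

end
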